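(* Let $G$ be an undirected loopless quantum graph with corresponding operator space $S$, and let $k\geq 1$. Then $G$ has a $k$-colouring if and only if it has a BGH $k$-colouring. Here: $G$ has a $k$-colouring if there exists a partition of $V(G)$ into projective subsets $P_1,\dots,P_k\sqsubseteq V(G)$ such that $E(G)$ and $P_s\times P_s$ are disjoint for all $s\in\{1,\dots,k\}$; and $G$ has a BGH $k$-colouring if there exist projections $p_1,\dots,p_k\in V(G)$ with $\sum_sp_s=1$ such that $p_sSp_s=0$ for all $s\in\{1,\dots,k\}$.
   Context: All Hilbert spaces are finite-dimensional; "projector" means orthogonal projector. Quantum sets. A quantum set is a special symmetric $\dagger$-Frobenius monoid in finite-dimensional Hilbert spaces; equivalently a finite-dimensional C*-algebra, up to isomorphism $X=\bigoplus_{i=1}^k M_{n_i}$ with the usual product, unit $1$ and involution, and inner product $\langle a,b\rangle=\sum_i n_i\mathrm{Tr}(a_i^*b_i)$, for which the multiplication $m:X\otimes X\to X$ satisfies $mm^\dagger=\mathrm{id}_X$. It acts block-diagonally on $H=\bigoplus_i\mathbb{C}^{n_i}$, so $X\subseteq B(H)$. Projective subsets. A projective subset $Y\sqsubseteq X$ is given by a projector $\widehat Y:X\to X$ with $\widehat Y(ab)=\widehat Y(a)b$ for all $a,b\in X$. These correspond bijectively to projections $\widetilde Y=\widehat Y(1)\in X$, via $\widehat Y(a)=\widetilde Ya$; $\widetilde Y$ is also viewed as a projector on $H$. The union $Y\cup Z$ has as its projection the projector onto $\mathrm{span}(\mathrm{img}\,\widetilde Y\cup\mathrm{img}\,\widetilde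 Z)$. $Y,Z\sqsubseteq X$ are disjoint if $\mathrm{img}\,\widetilde Y\perp\mathrm{img}\,\widetilde Z$. A partition of $X$ is a collection of mutually disjoint projective subsets $P_1,\dots,P_k\sqsubseteq X$ with $\bigcup_sP_s=X$ (the projective subset with projection $1$). Cartesian products. For $V\subseteq B(H)$, the quantum set $V^{op}\otimes V$ acts on $H^*\otimes H\cong B(H)$ (identify $\langle u|\otimes|v\rangle$ with $|v\rangle\langle u|$) by $(a\otimes b)\cdot x=bxa$; thus projections in $V^{op}\otimes V$ have images in $B(H)$, which carries the Hilbert–Schmidt inner product. For $Y,Z\sqsubseteq V$, $Y\times Z\sqsubseteq V^{op}\otimes V$ is the projective subset whose projection acts on $B(H)$ as $x\mapsto\widetilde Zx\widetilde Y$. Quantum graphs. A quantum graph $G$ is a quantum set $V=V(G)$ with an adjacency operator $A_G:V\to V$ satisfying $m(A_G\otimes A_G)m^\dagger=A_G$ and $A_G(x^* )=A_G(x)^*$. Equivalently, it is given by its edge relation $E(G)\sqsubseteq V^{op}\otimes V$, i.e. a projector $\widehat{E(G)}$ on $V\otimes V$ with $\widehat{E(G)}(ax\otimes yb)=(a\otimes 1)\widehat{E(G)}(x\otimes y)(1\otimes b)$, related by $\widehat{E(G)}=(\mathrm{id}\otimes m)(\mathrm{id}\otimes A_G\otimes\mathrm{id})(m^\dagger\otimes\mathrm{id})$. $G$ is undirected if $A_G=A_G^\dagger$ and loopless if $m(A_G\otimes\mathrm{id})m^\dagger=0$. The corresponding operator space of $G$ is $S=\mathrm{img}\,\widetilde{E(G)}\subseteq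 B(H)$. *)

theory Defs
  imports "HOL-Analysis.Analysis"
begin

section \<open>Quantum sets\<close>

text \<open>
  A quantum set \<open>X = M\<^bsub>n\<^sub>1\<^esub> \<oplus> \<dots> \<oplus> M\<^bsub>n\<^sub>k\<^esub>\<close>, acting on \<open>H = \<complex>\<^bsup>n\<^sub>1\<^esup> \<oplus> \<dots> \<oplus> \<complex>\<^bsup>n\<^sub>k\<^esup>\<close>, is given by a map \<open>V\<close> which
  sends each basis vector of \<open>H\<close> to (the name of) the block it belongs to. The basis of \<open>H\<close> is
  \<open>dom V\<close>, the blocks are \<open>ran V\<close> and \<open>n\<^sub>l\<close> is the number of indices that \<open>V\<close> sends to \<open>l\<close>. Since
  \<open>V\<close> is partial, \<open>dom V\<close> may be smaller than the ambient index type; in particular the zero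
  quantum set is included. All matrices and vectors below vanish outside \<open>dom V\<close>.
\<close>

type_synonym ('n, 'b) qset = "'n \<Rightarrow> 'b option"
type_synonym 'n cmat = "complex ^ 'n ^ 'n"

definition cscale :: "complex \<Rightarrow> 'n::finite cmat \<Rightarrow> 'n cmat" where
  "cscale c a = map_matrix ((*) c) a"

definition cadj :: "'n::finite cmat \<Rightarrow> 'n cmat" where
  "cadj a = map_matrix cnj (transpose a)"

definition qalg :: "('n::finite, 'b) qset \<Rightarrow> 'n cmat set" where
  "qalg V = {a. \<forall>i j. a $ i $ j \<noteq> 0 \<longrightarrow> i \<in> dom V \<and> V i = V j}"

definition qone :: "('n::finite, 'b) qset \<Rightarrow> 'n cmat" where
  "qone V = (\<chi> i j. if i = j \<and> i \<in> dom V then 1 else 0)"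

definition block_size :: "('n::finite, 'b) qset \<Rightarrow> 'b \<Rightarrow> nat" where
  "block_size V l = card {i. V i = Some l}"

definition qinner :: "('n::finite, 'b) qset \<Rightarrow> 'n cmat \<Rightarrow> 'n cmat \<Rightarrow> complex" where
  "qinner V a b =
     (\<Sum>l\<in>ran V. of_nat (block_size V l) * (\<Sum>i | V i = Some l. (cadj a ** b) $ i $ i))"

definition hspace :: "('n::finite, 'b) qset \<Rightarrow> (complex ^ 'n) set" where
  "hspace V = {v. \<forall>i. v $ i \<noteq> 0 \<longrightarrow> i \<in> dom V}"

definition cinner :: "complex ^ 'n \<Rightarrow> complex ^ 'n::finite \<Rightarrow> complex" where
  "cinner u v = (\<Sum>i\<in>UNIV. cnj (u $ i) * v $ i)"

definition bounded_ops :: "('n::finite, 'b) qset \<Rightarrow> 'n cmat set" where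
  "bounded_ops V = {x. \<forall>i j. x $ i $ j \<noteq> 0 \<longrightarrow> i \<in> dom V \<and> j \<in> dom V}"

definition hs_inner :: "'n::finite cmat \<Rightarrow> 'n cmat \<Rightarrow> complex" where
  "hs_inner x y = trace (cadj x ** y)"


section \<open>Linear maps and tensor products\<close>

definition qlinear ::
  "('n::finite, 'b) qset \<Rightarrow> ('m::finite, 'c) qset \<Rightarrow> ('n cmat \<Rightarrow> 'm cmat) \<Rightarrow> bool" where
  "qlinear V W f \<longleftrightarrow>
     (\<forall>a\<in>qalg V. f a \<in> qalg W) \<and>
     (\<forall>a\<in>qalg V. \<forall>b\<in>qalg V. f (a + b) = f a + f b) \<and>
     (\<forall>c. \<forall>a\<in>qalg V. f (cscale c a) = cscale c (f a))"

text \<open>The adjoint \<open>f\<^sup>\<dagger> : W \<rightarrow> V\<close> of a linear map \<open>f : V \<rightarrow> W\<close>; it exists and is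
  unique because \<open>qinner\<close> is positive definite on \<open>qalg\<close>.\<close>

definition qadjoint ::
  "('n::finite, 'b) qset \<Rightarrow> ('m::finite, 'c) qset \<Rightarrow> ('n cmat \<Rightarrow> 'm cmat) \<Rightarrow> 'm cmat \<Rightarrow> 'n cmat" where
  "qadjoint V W f b = (THE a. a \<in> qalg V \<and> (\<forall>c\<in>qalg V. qinner V c a = qinner W (f c) b))"

text \<open>
  The tensor product of quantum sets is again a quantum set: its blocks are the pairs of blocks,
  with sizes \<open>n\<^sub>l n\<^sub>l'\<close>, so that \<open>qinner\<close> for \<open>V \<otimes>\<^sub>q W\<close> is the inner product of the tensor product
  of Hilbert spaces.
\<close>

definition qtensor ::
  "('n::finite, 'b) qset \<Rightarrow> ('m::finite, 'c) qset \<Rightarrow> ('n \<times> 'm, 'b \<times> 'c) qset" (infixr "\<otimes>\<^sub>q" 70)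
  where
  "V \<otimes>\<^sub>q W = (\<lambda>(i, k). case (V i, W k) of (Some l, Some l') \<Rightarrow> Some (l, l') | _ \<Rightarrow> None)"

definition kron :: "'n::finite cmat \<Rightarrow> 'm::finite cmat \<Rightarrow> ('n \<times> 'm) cmat" where
  "kron a b = (\<chi> p q. a $ fst p $ fst q * b $ snd p $ snd q)"

definition matrix_unit :: "'n::finite \<Rightarrow> 'n \<Rightarrow> 'n cmat" where
  "matrix_unit i j = (\<chi> p q. if p = i \<and> q = j then 1 else 0)"

text \<open>
  \<open>f \<otimes> g\<close>, by expanding the argument in the basis of the \<open>E\<^sub>i\<^sub>j \<otimes> E\<^sub>k\<^sub>l\<close>. The coefficient is zero
  unless both matrix units lie in the algebras on which \<open>f\<close> and \<open>g\<close> are defined.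
\<close>

definition tensor_map ::
  "('n::finite cmat \<Rightarrow> 'n'::finite cmat) \<Rightarrow> ('m::finite cmat \<Rightarrow> 'm'::finite cmat)
     \<Rightarrow> ('n \<times> 'm) cmat \<Rightarrow> ('n' \<times> 'm') cmat" where
  "tensor_map f g t =
     (\<Sum>i\<in>UNIV. \<Sum>j\<in>UNIV. \<Sum>k\<in>UNIV. \<Sum>l\<in>UNIV.
        cscale (t $ (i, k) $ (j, l)) (kron (f (matrix_unit i j)) (g (matrix_unit k l))))"

definition tensor_assoc ::
  "(('n::finite \<times> 'm::finite) \<times> 'p::finite) cmat \<Rightarrow> ('n \<times> ('m \<times> 'p)) cmat" where
  "tensor_assoc t = (\<chi> p q. t $ ((fst p, fst (snd p)), snd (snd p)) $ ((fst q, fst (snd q)), snd (snd q)))"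

definition qmult :: "('n::finite \<times> 'n) cmat \<Rightarrow> 'n cmat" where
  "qmult t = (\<chi> i l. \<Sum>j\<in>UNIV. t $ (i, j) $ (j, l))"

lemma qmult_kron: "qmult (kron a b) = a ** b"
  by (simp add: qmult_def kron_def matrix_matrix_mult_def)

definition qcomult :: "('n::finite, 'b) qset \<Rightarrow> 'n cmat \<Rightarrow> ('n \<times> 'n) cmat" where
  "qcomult V = qadjoint (V \<otimes>\<^sub>q V) V qmult"


section \<open>Projective subsets\<close>

definition projector_map :: "('n::finite, 'b) qset \<Rightarrow> ('n cmat \<Rightarrow> 'n cmat) \<Rightarrow> bool" where
  "projector_map V Y \<longleftrightarrow>
     qlinear V V Y \<and> (\<forall>a\<in>qalg V. Y (Y a) = Y a) \<and> (\<forall>a\<in>qalg V. qadjoint V V Y a = Y a)"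

text \<open>A projective subset \<open>Y\<close> is represented by the map written \<open>Y\<close> with a wide hat.\<close>

definition projective_subset :: "('n::finite, 'b) qset \<Rightarrow> ('n cmat \<Rightarrow> 'n cmat) \<Rightarrow> bool" where
  "projective_subset V Y \<longleftrightarrow>
     projector_map V Y \<and> (\<forall>a\<in>qalg V. \<forall>b\<in>qalg V. Y (a ** b) = Y a ** b)"

definition proj_of :: "('n::finite, 'b) qset \<Rightarrow> ('n cmat \<Rightarrow> 'n cmat) \<Rightarrow> 'n cmat" where
  "proj_of V Y = Y (qone V)"

definition is_projection :: "'n::finite cmat \<Rightarrow> bool" where
  "is_projection p \<longleftrightarrow> p ** p = p \<and> cadj p = p"

definition img :: "('n::finite, 'b) qset \<Rightarrow> 'n cmat \<Rightarrow> (complex ^ 'n) set" where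
  "img V p = (\<lambda>v. p *v v) ` hspace V"

definition projector_onto :: "('n::finite, 'b) qset \<Rightarrow> (complex ^ 'n) set \<Rightarrow> 'n cmat" where
  "projector_onto V U = (THE p. p \<in> bounded_ops V \<and> is_projection p \<and> img V p = U)"

text \<open>The union of a family, which for a finite family is the iterated binary union.\<close>

definition qUnion ::
  "('n::finite, 'b) qset \<Rightarrow> 'i set \<Rightarrow> ('i \<Rightarrow> 'n cmat \<Rightarrow> 'n cmat) \<Rightarrow> 'n cmat \<Rightarrow> 'n cmat" where
  "qUnion V I P a = projector_onto V (vec.span (\<Union>s\<in>I. img V (proj_of V (P s)))) ** a"

definition disjoint_subsets ::
  "('n::finite, 'b) qset \<Rightarrow> ('n cmat \<Rightarrow> 'n cmat) \<Rightarrow> ('n cmat \<Rightarrow> 'n cmat) \<Rightarrow> bool" where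
  "disjoint_subsets V Y Z \<longleftrightarrow>
     (\<forall>u\<in>img V (proj_of V Y). \<forall>v\<in>img V (proj_of V Z). cinner u v = 0)"

definition is_partition ::
  "('n::finite, 'b) qset \<Rightarrow> 'i set \<Rightarrow> ('i \<Rightarrow> 'n cmat \<Rightarrow> 'n cmat) \<Rightarrow> bool" where
  "is_partition V I P \<longleftrightarrow>
     (\<forall>s\<in>I. projective_subset V (P s)) \<and>
     (\<forall>s\<in>I. \<forall>t\<in>I. s \<noteq> t \<longrightarrow> disjoint_subsets V (P s) (P t)) \<and>
     proj_of V (qUnion V I P) = qone V"


section \<open>Subsets of the product of a quantum set with itself\<close>

text \<open>
  The quantum set \<open>V\<^bsup>op\<^esup> \<otimes> V\<close> has \<open>V \<otimes>\<^sub>q V\<close> as its underlying Hilbert space, but the product is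
  \<open>(a \<otimes> b)(c \<otimes> d) = ca \<otimes> bd\<close>, and it acts on the operators on \<open>H\<close> by \<open>(a \<otimes> b) \<cdot> x = b x a\<close>.
\<close>

definition op_mult :: "('n::finite \<times> 'n) cmat \<Rightarrow> ('n \<times> 'n) cmat \<Rightarrow> ('n \<times> 'n) cmat" where
  "op_mult s t = (\<chi> p q. \<Sum>i\<in>UNIV. \<Sum>k\<in>UNIV. s $ (i, snd p) $ (fst q, k) * t $ (fst p, k) $ (i, snd q))"

lemma op_mult_kron: "op_mult (kron a b) (kron c d) = kron (c ** a) (b ** d)"
  by (simp add: op_mult_def kron_def matrix_matrix_mult_def vec_eq_iff sum_product mult_ac)

definition op_act :: "('n::finite \<times> 'n) cmat \<Rightarrow> 'n cmat \<Rightarrow> 'n cmat" where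
  "op_act t x = (\<chi> k j. \<Sum>i\<in>UNIV. \<Sum>l\<in>UNIV. t $ (i, k) $ (j, l) * x $ l $ i)"

lemma op_act_kron: "op_act (kron a b) x = b ** x ** a"
  by (simp add: op_act_def kron_def matrix_matrix_mult_def vec_eq_iff sum_distrib_left sum_distrib_right
      mult_ac)

definition op_img ::
  "('n::finite, 'b) qset \<Rightarrow> (('n \<times> 'n) cmat \<Rightarrow> ('n \<times> 'n) cmat) \<Rightarrow> 'n cmat set" where
  "op_img V E = op_act (proj_of (V \<otimes>\<^sub>q V) E) ` bounded_ops V"

definition op_disjoint ::
  "('n::finite, 'b) qset \<Rightarrow> (('n \<times> 'n) cmat \<Rightarrow> ('n \<times> 'n) cmat)
     \<Rightarrow> (('n \<times> 'n) cmat \<Rightarrow> ('n \<times> 'n) cmat) \<Rightarrow> bool" where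
  "op_disjoint V E F \<longleftrightarrow> (\<forall>x\<in>op_img V E. \<forall>y\<in>op_img V F. hs_inner x y = 0)"

definition qtimes ::
  "('n::finite, 'b) qset \<Rightarrow> ('n cmat \<Rightarrow> 'n cmat) \<Rightarrow> ('n cmat \<Rightarrow> 'n cmat)
     \<Rightarrow> ('n \<times> 'n) cmat \<Rightarrow> ('n \<times> 'n) cmat" where
  "qtimes V Y Z t = op_mult (kron (proj_of V Y) (proj_of V Z)) t"


section \<open>Quantum graphs\<close>

definition quantum_graph :: "('n::finite, 'b) qset \<Rightarrow> ('n cmat \<Rightarrow> 'n cmat) \<Rightarrow> bool" where
  "quantum_graph V A \<longleftrightarrow>
     qlinear V V A \<and>
     (\<forall>x\<in>qalg V. qmult (tensor_map A A (qcomult V x)) = A x) \<and>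
     (\<forall>x\<in>qalg V. A (cadj x) = cadj (A x))"

definition undirected :: "('n::finite, 'b) qset \<Rightarrow> ('n cmat \<Rightarrow> 'n cmat) \<Rightarrow> bool" where
  "undirected V A \<longleftrightarrow> (\<forall>x\<in>qalg V. qadjoint V V A x = A x)"

definition loopless :: "('n::finite, 'b) qset \<Rightarrow> ('n cmat \<Rightarrow> 'n cmat) \<Rightarrow> bool" where
  "loopless V A \<longleftrightarrow> (\<forall>x\<in>qalg V. qmult (tensor_map A id (qcomult V x)) = 0)"

definition edge_relation ::
  "('n::finite, 'b) qset \<Rightarrow> ('n cmat \<Rightarrow> 'n cmat) \<Rightarrow> ('n \<times> 'n) cmat \<Rightarrow> ('n \<times> 'n) cmat" where
  "edge_relation V A =
     tensor_map id qmult \<circ> tensor_map id (tensor_map A id) \<circ> tensor_assoc \<circ> tensor_map (qcomult V) id"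

definition operator_space :: "('n::finite, 'b) qset \<Rightarrow> ('n cmat \<Rightarrow> 'n cmat) \<Rightarrow> 'n cmat set" where
  "operator_space V A = op_img V (edge_relation V A)"

definition has_colouring :: "('n::finite, 'b) qset \<Rightarrow> ('n cmat \<Rightarrow> 'n cmat) \<Rightarrow> nat \<Rightarrow> bool" where
  "has_colouring V A k \<longleftrightarrow>
     (\<exists>P :: nat \<Rightarrow> 'n cmat \<Rightarrow> 'n cmat. is_partition V {1..k} P \<and>
        (\<forall>s\<in>{1..k}. op_disjoint V (edge_relation V A) (qtimes V (P s) (P s))))"

definition has_BGH_colouring :: "('n::finite, 'b) qset \<Rightarrow> ('n cmat \<Rightarrow> 'n cmat) \<Rightarrow> nat \<Rightarrow> bool" where
  "has_BGH_colouring V A k \<longleftrightarrow>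
     (\<exists>p :: nat \<Rightarrow> 'n cmat.
        (\<forall>s\<in>{1..k}. p s \<in> qalg V \<and> is_projection (p s)) \<and>
        (\<Sum>s = 1..k. p s) = qone V \<and>
        (\<forall>s\<in>{1..k}. \<forall>x\<in>operator_space V A. p s ** x ** p s = 0))"

end

theory Submission
  imports Defs
begin

text \<open>
  Evaluating at the unit identifies the projective subsets of \<open>V\<close> with the projections of
  \<open>qalg V\<close>, so both kinds of colouring are conditions on a family of projections \<open>p\<^sub>s\<close>, and they are
  compared condition by condition.

  \<^item> Partition against resolution of the unit. Images of projections are orthogonal exactly when the
    products \<open>p\<^sub>s p\<^sub>t\<close> vanish, and then the sum of the \<open>p\<^sub>s\<close> is the projector onto the union
    (\<open>projector_onto_orthogonal_sum\<close>); thus the \<open>p\<^sub>s\<close> of a partition add up to the unit. Conversely,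
    projections that add up to the unit are automatically orthogonal
    (\<open>sum_qone_imp_orthogonal\<close>): multiplying \<open>\<Sum>\<^sub>s p\<^sub>s = 1\<close> by \<open>p\<^sub>t\<close> from both sides leaves a sum of
    positive operators \<open>(p\<^sub>s p\<^sub>t)\<^sup>* (p\<^sub>s p\<^sub>t)\<close> that equals zero.

  \<^item> Disjointness from \<open>P\<^sub>s \<times> P\<^sub>s\<close> against compression. The image of \<open>P\<^sub>s \<times> P\<^sub>s\<close> is \<open>p\<^sub>s B(H) p\<^sub>s\<close>,
    and \<open>\<langle>x, p\<^sub>s y p\<^sub>s\<rangle> = \<langle>p\<^sub>s x p\<^sub>s, y\<rangle>\<close>; so \<open>x\<close> is orthogonal to this image exactly when
    \<open>p\<^sub>s x p\<^sub>s = 0\<close> (\<open>op_disjoint_qtimes_iff\<close>).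
\<close>

section \<open>Adjoints and inner products of matrices\<close>

lemma cadj_nth [simp]: "cadj a $ i $ j = cnj (a $ j $ i)"
  by (simp add: cadj_def map_matrix_def transpose_def)

lemma cscale_nth [simp]: "cscale c a $ i $ j = c * a $ i $ j"
  by (simp add: cscale_def map_matrix_def)

lemma cadj_cadj [simp]: "cadj (cadj a) = a"
  by (simp add: vec_eq_iff)

lemma cadj_mult: "cadj (a ** b) = cadj b ** cadj a"
  by (simp add: vec_eq_iff matrix_matrix_mult_def mult.commute)

lemma cadj_sum: "cadj (\<Sum>s\<in>I. f s) = (\<Sum>s\<in>I. cadj (f s))"
  by (simp add: vec_eq_iff)

lemma matrix_mult_sum_left: "(\<Sum>s\<in>I. f s) ** b = (\<Sum>s\<in>I. f s ** (b :: 'n::finite cmat))"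
  by (simp add: vec_eq_iff matrix_matrix_mult_def sum_distrib_right sum.swap[where A = I and B = UNIV])

lemma matrix_mult_sum_right: "b ** (\<Sum>s\<in>I. f s) = (\<Sum>s\<in>I. (b :: 'n::finite cmat) ** f s)"
  by (induction I rule: infinite_finite_induct) (auto simp: matrix_add_ldistrib)

lemma matrix_vector_mult_sum_left: "(\<Sum>s\<in>I. f s) *v v = (\<Sum>s\<in>I. (f s :: 'n::finite cmat) *v v)"
  by (induction I rule: infinite_finite_induct) (auto simp: matrix_vector_mult_add_rdistrib)

lemma trace_sum: "trace (\<Sum>s\<in>I. f s) = (\<Sum>s\<in>I. trace (f s :: 'n::finite cmat))"
  by (simp add: trace_def) (rule sum.swap)

lemma cinner_adjoint: "cinner (a *v u) v = cinner u (cadj a *v v)"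
proof -
  have "cinner (a *v u) v = (\<Sum>i\<in>UNIV. \<Sum>j\<in>UNIV. cnj (a $ i $ j) * cnj (u $ j) * v $ i)"
    by (simp add: cinner_def matrix_vector_mult_def sum_distrib_right)
  also have "\<dots> = (\<Sum>j\<in>UNIV. \<Sum>i\<in>UNIV. cnj (a $ i $ j) * cnj (u $ j) * v $ i)"
    by (rule sum.swap)
  also have "\<dots> = cinner u (cadj a *v v)"
    by (simp add: cinner_def matrix_vector_mult_def sum_distrib_left mult_ac)
  finally show ?thesis .
qed

lemma cinner_self_eq_0: "cinner u u = 0 \<Longrightarrow> u = 0"
proof -
  assume "cinner u u = 0"
  moreover have "cinner u u = complex_of_real (\<Sum>i\<in>UNIV. (cmod (u $ i))\<^sup>2)"
    unfolding cinner_def of_real_sum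
    by (rule sum.cong) (simp_all only: complex_norm_square mult.commute)
  ultimately have "(\<Sum>i\<in>UNIV. (cmod (u $ i))\<^sup>2) = 0" by (metis of_real_eq_0_iff)
  then have "\<forall>i. (cmod (u $ i))\<^sup>2 = 0" by (simp add: sum_nonneg_eq_0_iff)
  then show "u = 0" by (simp add: vec_eq_iff)
qed

lemma hs_inner_self:
  "hs_inner x x = complex_of_real (\<Sum>i\<in>UNIV. \<Sum>j\<in>UNIV. (cmod (x $ j $ i))\<^sup>2)"
  unfolding hs_inner_def trace_def matrix_matrix_mult_def of_real_sum vec_lambda_beta cadj_nth
  by (intro sum.cong refl) (simp only: complex_norm_square mult.commute)

lemma hs_inner_self_nonneg: "0 \<le> Re (hs_inner x x)"
  by (simp add: hs_inner_self sum_nonneg)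

lemma hs_inner_self_eq_0: "Re (hs_inner x x) = 0 \<Longrightarrow> x = 0"
  by (simp add: hs_inner_self sum_nonneg sum_nonneg_eq_0_iff vec_eq_iff)

lemma hs_inner_sandwich: "cadj p = p \<Longrightarrow> hs_inner x (p ** y ** p) = hs_inner (p ** x ** p) y"
proof -
  assume p: "cadj p = p"
  have "hs_inner x (p ** y ** p) = trace ((cadj x ** p ** y) ** p)"
    by (simp add: hs_inner_def matrix_mul_assoc)
  also have "\<dots> = trace (p ** (cadj x ** p ** y))" by (rule trace_mul_sym)
  also have "\<dots> = hs_inner (p ** x ** p) y"
    by (simp add: hs_inner_def cadj_mult p matrix_mul_assoc)
  finally show ?thesis .
qed


section \<open>The algebra of a quantum set and its Hilbert space\<close>

lemma qone_in_qalg [simp]: "qone V \<in> qalg V"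
  by (auto simp: qalg_def qone_def)

lemma qalg_imp_bounded: "a \<in> qalg V \<Longrightarrow> a \<in> bounded_ops V"
  unfolding qalg_def bounded_ops_def mem_Collect_eq domIff by metis

lemma qone_nth: "qone V $ i $ j = (if i = j then (if i \<in> dom V then 1 else 0) else 0)"
  by (simp add: qone_def)

lemma qone_mult:
  assumes "a \<in> bounded_ops V"
  shows "qone V ** a = a"
proof -
  have "(qone V ** a) $ i $ j = a $ i $ j" for i j
  proof -
    have "(qone V ** a) $ i $ j = (\<Sum>k\<in>UNIV. if k = i then if i \<in> dom V then a $ i $ j else 0 else 0)"
      unfolding matrix_matrix_mult_def vec_lambda_beta by (rule sum.cong) (auto simp: qone_nth)
    also have "\<dots> = (if i \<in> dom V then a $ i $ j else 0)" by simp
    also have "\<dots> = a $ i $ j" using assms unfolding bounded_ops_def mem_Collect_eq by metis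
    finally show ?thesis .
  qed
  then show ?thesis by (simp add: vec_eq_iff)
qed

lemma cadj_bounded: "a \<in> bounded_ops V \<Longrightarrow> cadj a \<in> bounded_ops V"
  by (auto simp: bounded_ops_def)

lemma cadj_qone: "cadj (qone V) = qone V"
  by (auto simp: vec_eq_iff qone_nth)

lemma mult_qone:
  assumes "a \<in> bounded_ops V"
  shows "a ** qone V = a"
  by (metis assms cadj_bounded cadj_cadj cadj_mult cadj_qone qone_mult)

lemma mult_nth_nonzero:
  fixes a b :: "'n::finite cmat"
  assumes "(a ** b) $ i $ j \<noteq> 0"
  obtains k where "a $ i $ k \<noteq> 0" "b $ k $ j \<noteq> 0"
proof -
  have "(\<Sum>k\<in>UNIV. a $ i $ k * b $ k $ j) \<noteq> 0"
    using assms by (simp add: matrix_matrix_mult_def)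
  then obtain k where "a $ i $ k * b $ k $ j \<noteq> 0" by (rule sum.not_neutral_contains_not_neutral)
  then show thesis using that by auto
qed

lemma mult_in_bounded:
  "a \<in> bounded_ops V \<Longrightarrow> b \<in> bounded_ops V \<Longrightarrow> a ** b \<in> bounded_ops V"
  unfolding bounded_ops_def by (blast elim: mult_nth_nonzero)

lemma sandwich_in_bounded: "p \<in> bounded_ops V \<Longrightarrow> p ** x ** p \<in> bounded_ops V"
  unfolding bounded_ops_def by (blast elim: mult_nth_nonzero)

lemma mult_in_qalg:
  assumes "a \<in> qalg V" "b \<in> qalg V"
  shows "a ** b \<in> qalg V"
  unfolding qalg_def
proof (intro CollectI allI impI)
  fix i j assume "(a ** b) $ i $ j \<noteq> 0"
  then obtain k where "a $ i $ k \<noteq> 0" "b $ k $ j \<noteq> 0" by (rule mult_nth_nonzero)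
  then have "i \<in> dom V" "V i = V k" "V k = V j" using assms by (auto simp only: qalg_def mem_Collect_eq)
  then show "i \<in> dom V \<and> V i = V j" by simp
qed

lemma cadj_in_qalg: "a \<in> qalg V \<Longrightarrow> cadj a \<in> qalg V"
  unfolding qalg_def mem_Collect_eq cadj_nth complex_cnj_zero_iff domIff by metis

lemma sum_in_bounded:
  assumes "\<And>s. s \<in> I \<Longrightarrow> f s \<in> bounded_ops V"
  shows "(\<Sum>s\<in>I. f s) \<in> bounded_ops V"
  unfolding bounded_ops_def
proof (intro CollectI allI impI)
  fix i j assume "(\<Sum>s\<in>I. f s) $ i $ j \<noteq> 0"
  then have "(\<Sum>s\<in>I. f s $ i $ j) \<noteq> 0" by simp
  then obtain s where "s \<in> I" "f s $ i $ j \<noteq> 0" by (rule sum.not_neutral_contains_not_neutral)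
  then show "i \<in> dom V \<and> j \<in> dom V" using assms unfolding bounded_ops_def by blast
qed

lemma bounded_mult_hspace:
  assumes "a \<in> bounded_ops V"
  shows "a *v v \<in> hspace V"
  unfolding hspace_def
proof (intro CollectI allI impI)
  fix i assume "(a *v v) $ i \<noteq> 0"
  then have "(\<Sum>j\<in>UNIV. a $ i $ j * v $ j) \<noteq> 0" by (simp add: matrix_vector_mult_def)
  then obtain j where "a $ i $ j * v $ j \<noteq> 0" by (rule sum.not_neutral_contains_not_neutral)
  then show "i \<in> dom V" using assms unfolding bounded_ops_def by force
qed

text \<open>An operator on \<open>H\<close> is determined by its values on \<open>H\<close>, although the matrix also acts on the
  coordinates outside \<open>dom V\<close>.\<close>

lemma bounded_ops_eqI:
  assumes "a \<in> bounded_ops V" "b \<in> bounded_ops V" "\<And>v. v \<in> hspace V \<Longrightarrow> a *v v = b *v v"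
  shows "a = b"
proof -
  have "a *v v = b *v v" for v
  proof -
    have "a *v (qone V *v v) = b *v (qone V *v v)"
      by (intro assms(3) bounded_mult_hspace qalg_imp_bounded qone_in_qalg)
    then show ?thesis
      by (simp add: matrix_vector_mul_assoc mult_qone assms)
  qed
  then show ?thesis by (simp add: matrix_eq)
qed

lemma subspace_hspace: "vec.subspace (hspace V)"
proof (rule vec.subspaceI)
  show "x + y \<in> hspace V" if "x \<in> hspace V" "y \<in> hspace V" for x y
    unfolding hspace_def
  proof (intro CollectI allI impI)
    fix i assume "(x + y) $ i \<noteq> 0"
    then have "x $ i \<noteq> 0 \<or> y $ i \<noteq> 0" by auto
    then show "i \<in> dom V" using that unfolding hspace_def by blast
  qed
qed (auto simp: hspace_def)

lemma subspace_img: "vec.subspace (img V p)"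
  unfolding img_def
  by (rule vec.linear_subspace_image[OF matrix_vector_mul_linear_gen subspace_hspace])


section \<open>Projections and their images\<close>

lemma projection_fixes_img: "is_projection p \<Longrightarrow> v \<in> img V p \<Longrightarrow> p *v v = v"
  by (auto simp: img_def is_projection_def matrix_vector_mul_assoc)

lemma projection_eqI:
  assumes "p \<in> bounded_ops V" "is_projection p" "q \<in> bounded_ops V" "is_projection q"
    and "img V p = img V q"
  shows "p = q"
proof -
  have *: "a ** b = b" if "a \<in> bounded_ops V" "is_projection a" "b \<in> bounded_ops V"
    "img V b = img V a" for a b
  proof (rule bounded_ops_eqI)
    fix v assume "v \<in> hspace V"
    then have "b *v v \<in> img V a" using that(4) by (auto simp: img_def)
    then show "(a ** b) *v v = b *v v"
      using projection_fixes_img[OF that(2)] by (simp flip: matrix_vector_mul_assoc)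
  qed (use that mult_in_bounded in auto)
  have "p ** q = q" "q ** p = p" using * assms by auto
  \<comment> \<open>Two projections with the same image absorb each other from the left; the adjoint turns one of
    these equations into absorption from the right.\<close>
  then show ?thesis
    by (metis assms(2,4) cadj_mult is_projection_def)
qed

lemma projector_onto_img:
  assumes "p \<in> bounded_ops V" "is_projection p"
  shows "projector_onto V (img V p) = p"
  unfolding projector_onto_def using assms by (auto intro: projection_eqI)

lemma img_orthogonal_iff:
  assumes "p \<in> bounded_ops V" "is_projection p" "q \<in> bounded_ops V"
  shows "(\<forall>u\<in>img V p. \<forall>v\<in>img V q. cinner u v = 0) \<longleftrightarrow> p ** q = 0"
proof
  assume orth: "\<forall>u\<in>img V p. \<forall>v\<in>img V q. cinner u v = 0"
  have "p ** q = 0"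
  proof (rule bounded_ops_eqI)
    fix v assume v: "v \<in> hspace V"
    \<comment> \<open>Since \<open>p\<close> is a projection, \<open>\<langle>p q v, p q v\<rangle> = \<langle>p q v, q v\<rangle>\<close>.\<close>
    have "cinner ((p ** q) *v v) ((p ** q) *v v) = cinner (p *v ((p ** q) *v v)) (q *v v)"
      unfolding cinner_adjoint[of p "(p ** q) *v v"]
      using assms(2) by (simp add: is_projection_def matrix_vector_mul_assoc)
    also have "\<dots> = 0"
      using v bounded_mult_hspace[OF mult_in_bounded[OF assms(1,3)]]
      by (intro orth[rule_format]) (auto simp: img_def)
    finally show "(p ** q) *v v = 0 *v v" by (simp add: cinner_self_eq_0)
  next
    show "p ** q \<in> bounded_ops V" using assms by (simp add: mult_in_bounded)
    show "0 \<in> bounded_ops V" by (simp add: bounded_ops_def)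
  qed
  then show "p ** q = 0" .
next
  assume "p ** q = 0"
  then show "\<forall>u\<in>img V p. \<forall>v\<in>img V q. cinner u v = 0"
    using assms(2)
    by (auto simp: img_def cinner_adjoint is_projection_def matrix_vector_mul_assoc)
      (simp add: cinner_def)
qed

text \<open>The sum of orthogonal projections is the projection onto the span of their images: it fixes
  each of these images, and it maps every vector to a sum of vectors taken from them.\<close>

lemma projector_onto_orthogonal_sum:
  assumes "finite I" and p: "\<And>s. s \<in> I \<Longrightarrow> p s \<in> bounded_ops V" "\<And>s. s \<in> I \<Longrightarrow> is_projection (p s)"
    and orth: "\<And>s t. s \<in> I \<Longrightarrow> t \<in> I \<Longrightarrow> s \<noteq> t \<Longrightarrow> p s ** p t = 0"
  shows "projector_onto V (vec.span (\<Union>s\<in>I. img V (p s))) = (\<Sum>s\<in>I. p s)"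
proof -
  let ?q = "\<Sum>s\<in>I. p s"
  have absorb: "?q ** p t = p t" if "t \<in> I" for t
  proof -
    have "?q ** p t = (\<Sum>s\<in>I. if s = t then p t else 0)"
      unfolding matrix_mult_sum_left
      using orth p(2) that by (intro sum.cong) (auto simp: is_projection_def)
    then show ?thesis using that assms(1) by simp
  qed
  have bounded: "?q \<in> bounded_ops V" by (rule sum_in_bounded) (rule p)
  have proj: "is_projection ?q"
    using p(2) absorb by (simp add: is_projection_def cadj_sum matrix_mult_sum_right)
  have "vec.span (\<Union>s\<in>I. img V (p s)) = img V ?q"
  proof (rule antisym)
    show "vec.span (\<Union>s\<in>I. img V (p s)) \<subseteq> img V ?q"
    proof (rule vec.span_minimal[OF _ subspace_img], safe)
      fix t v assume t: "t \<in> I" and v: "v \<in> img V (p t)"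
      then obtain w where w: "v = p t *v w" by (auto simp: img_def)
      have "v = ?q *v v" using absorb[OF t] by (simp add: w matrix_vector_mul_assoc)
      moreover have "v \<in> hspace V" using w bounded_mult_hspace p(1) t by blast
      ultimately show "v \<in> img V ?q" unfolding img_def by (rule image_eqI)
    qed
    show "img V ?q \<subseteq> vec.span (\<Union>s\<in>I. img V (p s))"
    proof
      fix u assume "u \<in> img V ?q"
      then obtain v where "v \<in> hspace V" and u: "u = (\<Sum>s\<in>I. p s *v v)"
        by (auto simp: img_def matrix_vector_mult_sum_left)
      then have "p s *v v \<in> (\<Union>s\<in>I. img V (p s))" if "s \<in> I" for s
        using that by (auto simp: img_def)
      then show "u \<in> vec.span (\<Union>s\<in>I. img V (p s))"
        unfolding u by (intro vec.span_sum vec.span_base)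
    qed
  qed
  then show ?thesis using projector_onto_img[OF bounded proj] by simp
qed

text \<open>Compressing \<open>\<Sum>\<^sub>s p\<^sub>s = 1\<close> by \<open>p\<^sub>t\<close> gives \<open>p\<^sub>t + \<Sum>\<^sub>s\<^sub>\<noteq>\<^sub>t (p\<^sub>s p\<^sub>t)\<^sup>* (p\<^sub>s p\<^sub>t) = p\<^sub>t\<close>. The trace
  of the sum that remains is a sum of squared Hilbert-Schmidt norms, so each \<open>p\<^sub>s p\<^sub>t\<close> is zero.\<close>

lemma sum_qone_imp_orthogonal:
  assumes fin: "finite I" and p: "\<And>s. s \<in> I \<Longrightarrow> p s \<in> bounded_ops V" "\<And>s. s \<in> I \<Longrightarrow> is_projection (p s)"
    and sum: "(\<Sum>s\<in>I. p s) = qone V"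
    and "s \<in> I" "t \<in> I" "s \<noteq> t"
  shows "p s ** p t = 0"
proof -
  have hs: "hs_inner (p r ** p t) (p r ** p t) = trace (p t ** p r ** p t)" if "r \<in> I" for r
  proof -
    have "cadj (p r) = p r" "cadj (p t) = p t"
      using p(2)[OF that] p(2)[OF \<open>t \<in> I\<close>] by (auto simp: is_projection_def)
    then have "cadj (p r ** p t) ** (p r ** p t) = p t ** (p r ** p r) ** p t"
      by (simp only: cadj_mult matrix_mul_assoc)
    then show ?thesis using p(2)[OF that] by (simp add: hs_inner_def is_projection_def)
  qed
  have pt: "p t ** p t = p t" using p(2)[OF \<open>t \<in> I\<close>] by (simp add: is_projection_def)
  have "(\<Sum>r\<in>I. p t ** p r ** p t) = p t ** (\<Sum>r\<in>I. p r) ** p t"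
    by (simp add: matrix_mult_sum_left matrix_mult_sum_right)
  also have "\<dots> = p t" by (simp add: sum mult_qone p \<open>t \<in> I\<close> pt)
  finally have "p t + (\<Sum>r\<in>I - {t}. p t ** p r ** p t) = p t"
    by (simp only: sum.remove[OF fin \<open>t \<in> I\<close>] pt)
  then have "trace (\<Sum>r\<in>I - {t}. p t ** p r ** p t) = 0" by (simp add: trace_def)
  then have "(\<Sum>r\<in>I - {t}. hs_inner (p r ** p t) (p r ** p t)) = 0"
    by (simp add: hs trace_sum)
  then have "(\<Sum>r\<in>I - {t}. Re (hs_inner (p r ** p t) (p r ** p t))) = 0"
    by (metis Re_sum zero_complex.sel(1))
  then have "Re (hs_inner (p s ** p t) (p s ** p t)) = 0"
    using fin assms(5,7) by (subst (asm) sum_nonneg_eq_0_iff) (auto simp: hs_inner_self_nonneg)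
  then show ?thesis by (rule hs_inner_self_eq_0)
qed


section \<open>Projective subsets are projections\<close>

text \<open>Pairing with the matrix unit \<open>E\<^sub>i\<^sub>j\<close> reads off the entry at \<open>(i, j)\<close>, up to the size of
  the block; this makes the inner product of a quantum set nondegenerate.\<close>

lemma qinner_matrix_unit:
  assumes "V i = Some l" "V j = Some l"
  shows "qinner V (matrix_unit i j) a = of_nat (block_size V l) * a $ i $ j"
proof -
  have "(cadj (matrix_unit i j) ** a) $ m $ m = (if m = j then a $ i $ j else 0)" for m
  proof -
    have "(cadj (matrix_unit i j) ** a) $ m $ m =
        (\<Sum>k\<in>UNIV. if k = i then if m = j then a $ i $ j else 0 else 0)"
      unfolding matrix_matrix_mult_def vec_lambda_beta
      by (rule sum.cong) (auto simp: matrix_unit_def)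
    then show ?thesis by simp
  qed
  then have "qinner V (matrix_unit i j) a =
      (\<Sum>l'\<in>ran V. if l' = l then of_nat (block_size V l) * a $ i $ j else 0)"
    unfolding qinner_def using assms by (intro sum.cong) auto
  moreover have "finite (ran V)" by (rule finite_ran) simp
  ultimately show ?thesis using assms by (auto simp: ranI)
qed

lemma qinner_cancel:
  assumes "a \<in> qalg V" "b \<in> qalg V" "\<And>c. c \<in> qalg V \<Longrightarrow> qinner V c a = qinner V c b"
  shows "a = b"
proof -
  have "a $ i $ j = b $ i $ j" for i j
  proof (cases "i \<in> dom V \<and> V i = V j")
    case True
    then obtain l where l: "V i = Some l" "V j = Some l" by (metis domD)
    then have "matrix_unit i j \<in> qalg V" by (auto simp: qalg_def matrix_unit_def)
    then have "of_nat (block_size V l) * a $ i $ j = of_nat (block_size V l) * b $ i $ j"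
      using assms(3) qinner_matrix_unit[OF l] by metis
    moreover have "block_size V l \<noteq> 0" using l by (auto simp: block_size_def)
    ultimately show ?thesis by simp
  next
    case False
    then show ?thesis using assms(1,2) unfolding qalg_def by (metis (mono_tags, lifting) mem_Collect_eq)
  qed
  then show ?thesis by (simp add: vec_eq_iff)
qed

lemma qadjoint_left_mult:
  assumes "p \<in> qalg V" "b \<in> qalg V" "\<And>a. a \<in> qalg V \<Longrightarrow> Y a = p ** a"
  shows "qadjoint V V Y b = cadj p ** b"
proof -
  have adj: "qinner V c (cadj p ** b) = qinner V (Y c) b" if "c \<in> qalg V" for c
    using that by (simp add: qinner_def assms(3) cadj_mult matrix_mul_assoc)
  have mem: "cadj p ** b \<in> qalg V" using assms by (simp add: mult_in_qalg cadj_in_qalg)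
  show ?thesis
    unfolding qadjoint_def
  proof (rule the_equality)
    show "cadj p ** b \<in> qalg V \<and> (\<forall>c\<in>qalg V. qinner V c (cadj p ** b) = qinner V (Y c) b)"
      using adj mem by blast
    show "a = cadj p ** b"
      if "a \<in> qalg V \<and> (\<forall>c\<in>qalg V. qinner V c a = qinner V (Y c) b)" for a
      by (rule qinner_cancel) (use that adj mem in auto)
  qed
qed

text \<open>A right module map is left multiplication by its value at the unit, and the adjoint of a left
  multiplication is the left multiplication by the adjoint.\<close>

lemma proj_of_projection:
  assumes "projective_subset V Y"
  shows "proj_of V Y \<in> qalg V" "is_projection (proj_of V Y)"
proof -
  let ?p = "proj_of V Y"
  have pm: "projector_map V Y" and module: "\<And>a b. a \<in> qalg V \<Longrightarrow> b \<in> qalg V \<Longrightarrow> Y (a ** b) = Y a ** b"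
    using assms by (auto simp: projective_subset_def)
  show p: "?p \<in> qalg V" using pm by (auto simp: projector_map_def qlinear_def proj_of_def)
  have Y: "Y a = ?p ** a" if "a \<in> qalg V" for a
    using module[OF qone_in_qalg that] that by (simp add: qone_mult qalg_imp_bounded proj_of_def)
  have "Y ?p = ?p" using pm by (simp add: projector_map_def proj_of_def)
  then have "?p ** ?p = ?p" using Y p by simp
  moreover have "cadj ?p ** qone V = ?p"
    using pm qadjoint_left_mult[OF p qone_in_qalg Y] by (simp add: projector_map_def proj_of_def)
  then have "cadj ?p = ?p" using p by (simp add: mult_qone cadj_in_qalg qalg_imp_bounded)
  ultimately show "is_projection ?p" by (simp add: is_projection_def)
qed

lemma projective_subset_left_mult:
  fixes p :: "'n::finite cmat"
  assumes "p \<in> qalg V" "is_projection p"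
  shows "projective_subset V ((**) p)"
proof -
  have "p ** cscale c a = cscale c (p ** a)" for c a
    by (simp add: vec_eq_iff matrix_matrix_mult_def sum_distrib_left mult_ac)
  moreover have "qadjoint V V ((**) p) a = p ** a" if "a \<in> qalg V" for a
    using qadjoint_left_mult[of p V a "(**) p"] assms that by (simp add: is_projection_def)
  moreover have "p ** (p ** a) = p ** a" for a :: "'n cmat"
    using assms(2) by (simp add: matrix_mul_assoc is_projection_def)
  ultimately show ?thesis
    using assms(1)
    by (auto simp: projective_subset_def projector_map_def qlinear_def mult_in_qalg
        matrix_add_ldistrib matrix_mul_assoc)
qed

lemma proj_of_left_mult: "p \<in> qalg V \<Longrightarrow> proj_of V ((**) p) = p"
  by (simp add: proj_of_def mult_qone qalg_imp_bounded)

text \<open>Pairwise disjointness appears on both sides because the sum of the projections is the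
  projector onto their union only for orthogonal projections.\<close>

lemma is_partition_iff:
  assumes "finite I"
  shows "is_partition V I P \<longleftrightarrow>
    (\<forall>s\<in>I. projective_subset V (P s)) \<and>
    (\<forall>s\<in>I. \<forall>t\<in>I. s \<noteq> t \<longrightarrow> proj_of V (P s) ** proj_of V (P t) = 0) \<and>
    (\<Sum>s\<in>I. proj_of V (P s)) = qone V"
proof (cases "\<forall>s\<in>I. projective_subset V (P s)")
  case True
  let ?p = "\<lambda>s. proj_of V (P s)"
  have p: "?p s \<in> bounded_ops V" "is_projection (?p s)" if "s \<in> I" for s
    using True that proj_of_projection qalg_imp_bounded by blast+
  have disj: "disjoint_subsets V (P s) (P t) \<longleftrightarrow> ?p s ** ?p t = 0" if "s \<in> I" "t \<in> I" for s t
    unfolding disjoint_subsets_def using p that by (intro img_orthogonal_iff) auto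
  have "proj_of V (qUnion V I P) = (\<Sum>s\<in>I. ?p s)"
    if "\<forall>s\<in>I. \<forall>t\<in>I. s \<noteq> t \<longrightarrow> ?p s ** ?p t = 0"
    unfolding proj_of_def[of V "qUnion V I P"] qUnion_def
    using projector_onto_orthogonal_sum[of I ?p V] assms p that
    by (simp add: mult_qone sum_in_bounded)
  with True disj show ?thesis unfolding is_partition_def by auto
next
  case False
  then show ?thesis unfolding is_partition_def by blast
qed


section \<open>Disjointness from a square\<close>

lemma qone_qtensor: "qone (V \<otimes>\<^sub>q W) = kron (qone V) (qone W)"
  by (auto simp: vec_eq_iff qone_nth kron_def qtensor_def dom_def prod_eq_iff split: option.splits)

lemma op_img_qtimes:
  assumes "proj_of V Y \<in> bounded_ops V" "proj_of V Z \<in> bounded_ops V"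
  shows "op_img V (qtimes V Y Z) = (\<lambda>x. proj_of V Z ** x ** proj_of V Y) ` bounded_ops V"
proof -
  have "proj_of (V \<otimes>\<^sub>q V) (qtimes V Y Z) = kron (proj_of V Y) (proj_of V Z)"
    unfolding proj_of_def[of "V \<otimes>\<^sub>q V"] qtimes_def
    by (simp add: qone_qtensor op_mult_kron qone_mult mult_qone assms)
  then show ?thesis by (auto simp: op_img_def op_act_kron)
qed

text \<open>The compression \<open>p x p\<close> is itself an operator on \<open>H\<close>, so that it can be paired with itself.\<close>

lemma op_disjoint_qtimes_iff:
  assumes "projective_subset V Y"
  shows "op_disjoint V E (qtimes V Y Y) \<longleftrightarrow>
    (\<forall>x\<in>op_img V E. proj_of V Y ** x ** proj_of V Y = 0)"
proof -
  let ?p = "proj_of V Y"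
  have p: "?p \<in> bounded_ops V" "cadj ?p = ?p"
    using proj_of_projection[OF assms] by (auto simp: qalg_imp_bounded is_projection_def)
  have "(\<forall>y\<in>bounded_ops V. hs_inner (?p ** x ** ?p) y = 0) \<longleftrightarrow> ?p ** x ** ?p = 0" for x
  proof
    assume "\<forall>y\<in>bounded_ops V. hs_inner (?p ** x ** ?p) y = 0"
    then have "hs_inner (?p ** x ** ?p) (?p ** x ** ?p) = 0"
      using sandwich_in_bounded[OF p(1)] by blast
    then show "?p ** x ** ?p = 0" by (simp add: hs_inner_self_eq_0)
  qed (simp add: hs_inner_def trace_def matrix_matrix_mult_def)
  then show ?thesis
    by (simp add: op_disjoint_def op_img_qtimes p hs_inner_sandwich)
qed


section \<open>Colourings\<close>

theorem proposition4p22: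
  fixes V :: "('n::finite, 'b) qset"
    and A :: "'n cmat \<Rightarrow> 'n cmat"
    and k :: nat
  assumes "quantum_graph V A"
    and "undirected V A"
    and "loopless V A"
    and "k \<ge> 1"
  shows "has_colouring V A k \<longleftrightarrow> has_BGH_colouring V A k"
proof
  assume "has_colouring V A k"
  then obtain P where P: "is_partition V {1..k} P"
    and E: "\<forall>s\<in>{1..k}. op_disjoint V (edge_relation V A) (qtimes V (P s) (P s))"
    by (auto simp: has_colouring_def)
  have ps: "\<forall>s\<in>{1..k}. projective_subset V (P s)" and sum: "(\<Sum>s=1..k. proj_of V (P s)) = qone V"
    using P by (auto simp: is_partition_iff)
  show "has_BGH_colouring V A k"
    unfolding has_BGH_colouring_def
  proof (intro exI[of _ "\<lambda>s. proj_of V (P s)"] conjI)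
    show "\<forall>s\<in>{1..k}. proj_of V (P s) \<in> qalg V \<and> is_projection (proj_of V (P s))"
      using ps proj_of_projection by blast
    show "(\<Sum>s = 1..k. proj_of V (P s)) = qone V" by (rule sum)
    show "\<forall>s\<in>{1..k}. \<forall>x\<in>operator_space V A. proj_of V (P s) ** x ** proj_of V (P s) = 0"
      using E ps by (simp add: op_disjoint_qtimes_iff operator_space_def)
  qed
next
  assume "has_BGH_colouring V A k"
  then obtain p where p: "\<forall>s\<in>{1..k}. p s \<in> qalg V \<and> is_projection (p s)"
    and sum: "(\<Sum>s = 1..k. p s) = qone V"
    and S: "\<forall>s\<in>{1..k}. \<forall>x\<in>operator_space V A. p s ** x ** p s = 0"
    by (auto simp: has_BGH_colouring_def)
  have ps: "projective_subset V ((**) (p s))" "proj_of V ((**) (p s)) = p s" if "s \<in> {1..k}" for s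
    using p that by (auto simp: projective_subset_left_mult proj_of_left_mult)
  have orth: "p s ** p t = 0" if "s \<in> {1..k}" "t \<in> {1..k}" "s \<noteq> t" for s t
    by (rule sum_qone_imp_orthogonal[of "{1..k}" p V])
      (use p sum that in \<open>auto simp: qalg_imp_bounded\<close>)
  show "has_colouring V A k"
    unfolding has_colouring_def
  proof (intro exI[of _ "\<lambda>s. (**) (p s)"] conjI)
    show "is_partition V {1..k} (\<lambda>s. (**) (p s))"
      using ps orth sum by (simp add: is_partition_iff)
    show "\<forall>s\<in>{1..k}. op_disjoint V (edge_relation V A) (qtimes V ((**) (p s)) ((**) (p s)))"
      using S ps by (simp add: op_disjoint_qtimes_iff operator_space_def)
  qed
qed

end
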